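(* Let $R$ be a commutative ring, let $n\in\mathbb{N}$, and let $A$ be a nullcyclic $n\times n$-matrix over $R$. Then $A^m$ is nullcyclic for every $m\in\mathbb{N}$.
   Context: All rings are commutative, associative and unital; $\mathbb{N}=\{0,1,2,\ldots\}$ and $[n]:=\{1,2,\ldots,n\}$. A cycle on $[n]$ is a $k$-tuple $C=(i_1,i_2,\ldots,i_k)$ with $k>0$ and $i_1,\ldots,i_k$ distinct elements of $[n]$, considered up to cyclic rotation; it is nontrivial if $k>1$. For a matrix $A=(a_{i,j})_{i,j\in[n]}$ over $R$, the $A$-weight of a cycle $C=(i_1,\ldots,i_k)$ is $w_A(C):=a_{i_1,i_2}a_{i_2,i_3}\cdots a_{i_{k-1},i_k}a_{i_k,i_1}$. The matrix $A$ is nullcyclic if $w_A(C)=0$ for each nontrivial cycle $C$ on $[n]$. *)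

theory Defs
  imports Jordan_Normal_Form.Matrix
begin

text \<open>
  The sort \<open>{comm_ring, comm_monoid_mult}\<close> is that of commutative, associative, unital rings,
  with the zero ring allowed; \<open>comm_ring_1\<close> would additionally impose \<open>0 \<noteq> 1\<close>.

  Row and column indices of an \<open>n \<times> n\<close> matrix run over \<open>{0..<n}\<close>, so \<open>{0..<n}\<close> plays the role
  of \<open>{1, \<dots>, n}\<close>.
\<close>

text \<open>
  A list \<open>[i\<^sub>1, \<dots>, i\<^sub>k]\<close> is a representative of the cycle \<open>(i\<^sub>1, \<dots>, i\<^sub>k)\<close>, which is itself only
  determined up to rotation. Being a cycle, being nontrivial and the weight do not depend on the
  representative (\<open>is_cycle_rotate1\<close>, \<open>cycle_weight_rotate1\<close> below), so quantifying over all
  representatives is the same as quantifying over all cycles.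
\<close>

definition is_cycle :: "nat \<Rightarrow> nat list \<Rightarrow> bool" where
  "is_cycle n c \<longleftrightarrow> length c > 0 \<and> distinct c \<and> set c \<subseteq> {0..<n}"

definition nontrivial_cycle :: "nat \<Rightarrow> nat list \<Rightarrow> bool" where
  "nontrivial_cycle n c \<longleftrightarrow> is_cycle n c \<and> length c > 1"

text \<open>The index is reduced modulo the length for the sake of the last factor, \<open>a\<close> at \<open>(i\<^sub>k, i\<^sub>1)\<close>.\<close>

definition cycle_weight :: "'a :: comm_monoid_mult mat \<Rightarrow> nat list \<Rightarrow> 'a" where
  "cycle_weight A c = (\<Prod>j<length c. A $$ (c ! j, c ! (Suc j mod length c)))"

definition nullcyclic :: "nat \<Rightarrow> 'a :: {comm_ring, comm_monoid_mult} mat \<Rightarrow> bool" where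
  "nullcyclic n A \<longleftrightarrow> (\<forall>c. nontrivial_cycle n c \<longrightarrow> cycle_weight A c = 0)"

text \<open>
  The library's matrix power \<open>(^\<^sub>m)\<close> requires \<open>0 \<noteq> 1\<close>. The same recursion works over the zero
  ring, and agrees with \<open>(^\<^sub>m)\<close> whenever the latter is defined.
\<close>

primrec mat_power :: "'a :: {comm_ring, comm_monoid_mult} mat \<Rightarrow> nat \<Rightarrow> 'a mat" where
  "mat_power A 0 = 1\<^sub>m (dim_row A)"
| "mat_power A (Suc m) = mat_power A m * A"

lemma mat_power_eq_pow_mat: "mat_power (A :: 'a :: comm_ring_1 mat) m = A ^\<^sub>m m"
  by (induction m) simp_all

lemma is_cycle_rotate1: "is_cycle n (rotate1 c) \<longleftrightarrow> is_cycle n c"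
  by (simp add: is_cycle_def)

lemma cycle_weight_rotate1: "cycle_weight A (rotate1 c) = cycle_weight A c"
proof (cases "c = []")
  case False
  define k where "k = length c"
  have k: "k > 0" using False by (simp add: k_def)
  let ?s = "\<lambda>j. Suc j mod k"
  have inj: "inj_on ?s {..<k}"
    by (rule inj_onI) (auto simp: mod_Suc split: if_splits)
  have img: "?s ` {..<k} = {..<k}"
    by (rule endo_inj_surj) (use k inj in auto)
  have "cycle_weight A (rotate1 c) = (\<Prod>j<k. A $$ (c ! ?s j, c ! ?s (?s j)))"
    unfolding cycle_weight_def
    by (rule prod.cong) (use k in \<open>auto simp: nth_rotate1 k_def\<close>)
  also have "\<dots> = (\<Prod>j\<in>?s ` {..<k}. A $$ (c ! j, c ! ?s j))"
    using inj by (simp add: prod.reindex)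
  also have "\<dots> = cycle_weight A c"
    unfolding img by (simp add: cycle_weight_def k_def)
  finally show ?thesis .
qed simp

end

theory Submission
  imports Defs
begin

text \<open>
  An entry of \<open>A\<^sup>m\<close> is a sum of \<open>A\<close>-weights of walks, so the \<open>A\<^sup>m\<close>-weight of a nontrivial cycle is a
  sum of \<open>A\<close>-weights of closed walks that visit all vertices of the cycle, hence at least two
  distinct vertices. The theorem thus reduces to the claim that, for nullcyclic \<open>A\<close>, every closed
  walk that leaves its starting point has weight \<open>0\<close> (\<open>closed_walk_weight_eq_0\<close>): such a walk is
  a nontrivial cycle if it repeats no vertex; otherwise it can be cut at a repeated vertex into two
  shorter closed walks, whose weights multiply to its weight and which cannot both be constant.

  The sum over walks never needs to be written down. Only its vanishing matters, and
  \<open>mult_mat_power_entry_eq_0\<close> and \<open>mult_walk_weight_mat_power_eq_0\<close> derive that directly from the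
  vanishing of all terms. The extra factor \<open>r\<close> there stands for the remaining factors of the
  product, which the inductions leave aside.
\<close>

fun walk_weight :: "'a :: comm_monoid_mult mat \<Rightarrow> nat list \<Rightarrow> 'a" where
  "walk_weight A (x # y # p) = A $$ (x, y) * walk_weight A (y # p)"
| "walk_weight A _ = 1"

lemma walk_weight_append:
  "walk_weight A (p @ x # q) = walk_weight A (p @ [x]) * walk_weight A (x # q)"
proof (induction p)
  case (Cons y p)
  then show ?case by (cases p) (simp_all add: mult.assoc)
qed simp

lemma walk_weight_snoc:
  assumes "p \<noteq> []"
  shows "walk_weight A (p @ [y]) = walk_weight A p * A $$ (last p, y)"
  using assms walk_weight_append[of A _ "last p" "[y]"] by (cases p rule: rev_cases) simp_all

lemma walk_weight_eq_prod:
  "walk_weight A (x # p) = (\<Prod>j<length p. A $$ ((x # p) ! j, p ! j))"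
proof (induction p arbitrary: x)
  case (Cons y p)
  then show ?case
    by (simp add: prod.lessThan_Suc_shift del: prod.lessThan_Suc)
qed simp

lemma cycle_weight_eq_walk_weight:
  assumes "c \<noteq> []"
  shows "cycle_weight A c = walk_weight A (c @ [hd c])"
proof -
  obtain x p where c: "c = x # p" using assms by (cases c) auto
  have "walk_weight A (c @ [hd c]) = (\<Prod>j<length c. A $$ ((c @ [x]) ! j, (p @ [x]) ! j))"
    using walk_weight_eq_prod[of A x "p @ [x]"] by (simp add: c)
  also have "\<dots> = cycle_weight A c"
    unfolding cycle_weight_def
  proof (rule prod.cong)
    fix j assume "j \<in> {..<length c}"
    then have j: "j < length c" by simp
    then have "(c @ [x]) ! j = c ! j" by (simp only: nth_append if_True)
    moreover have "(p @ [x]) ! j = c ! (Suc j mod length c)"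
    proof (cases "j < length p")
      case True
      then have "Suc j mod length c = Suc j" by (simp add: c)
      with True show ?thesis by (simp add: c nth_append)
    next
      case False
      with j have "j = length p" by (simp add: c)
      then show ?thesis by (simp add: c)
    qed
    ultimately show "A $$ ((c @ [x]) ! j, (p @ [x]) ! j) = A $$ (c ! j, c ! (Suc j mod length c))"
      by simp
  qed simp
  finally show ?thesis by simp
qed

text \<open>
  The list \<open>c\<close> omits the return to the starting point. A repeated vertex \<open>z\<close> of \<open>c\<close> splits the
  closed walk into the excursion from \<open>z\<close> to \<open>z\<close> and the walk that skips it. Since both contain
  \<open>z\<close>, they cannot both be constant without the whole walk being so.
\<close>
lemma closed_walk_weight_eq_0:
  fixes A :: "'a :: {comm_ring, comm_monoid_mult} mat"
  assumes "nullcyclic n A" and "set c \<subseteq> {0..<n}" and "x \<in> set c" "y \<in> set c" "x \<noteq> y"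
  shows "walk_weight A (c @ [hd c]) = 0"
  using assms(2-)
proof (induction "length c" arbitrary: c x y rule: less_induct)
  case less
  have "c \<noteq> []" using less.prems by auto
  show ?case
  proof (cases "distinct c")
    case True
    have "length c \<noteq> 1"
      using less.prems by (auto simp: length_Suc_conv)
    with \<open>c \<noteq> []\<close> True less.prems(1) have "nontrivial_cycle n c"
      by (cases "length c") (auto simp: nontrivial_cycle_def is_cycle_def)
    then show ?thesis
      using assms(1) cycle_weight_eq_walk_weight[OF \<open>c \<noteq> []\<close>, of A] by (simp add: nullcyclic_def)
  next
    case False
    then obtain p z q s where c: "c = p @ [z] @ q @ [z] @ s"
      using not_distinct_decomp by blast
    let ?c1 = "z # q" and ?c2 = "p @ z # s"
    have hd: "hd c = hd ?c2" unfolding c by (cases p) auto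
    have "walk_weight A (c @ [hd c]) = walk_weight A (p @ [z]) * (walk_weight A (z # q @ [z])
        * walk_weight A (z # s @ [hd c]))"
      using walk_weight_append[of A p z "q @ z # s @ [hd c]"]
        walk_weight_append[of A "z # q" z "s @ [hd c]"] by (simp add: c)
    also have "\<dots> = walk_weight A (?c1 @ [hd ?c1]) * walk_weight A (?c2 @ [hd ?c2])"
      using walk_weight_append[of A p z "s @ [hd c]"] by (simp add: hd mult_ac)
    finally have split: "walk_weight A (c @ [hd c])
        = walk_weight A (?c1 @ [hd ?c1]) * walk_weight A (?c2 @ [hd ?c2])" .
    obtain v where v: "v \<noteq> z" "v \<in> set c"
      using less.prems(2-4) by metis
    from v(2) have "v \<in> set ?c1 \<or> v \<in> set ?c2" by (auto simp: c)
    then show ?thesis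
    proof
      assume "v \<in> set ?c1"
      then have "walk_weight A (?c1 @ [hd ?c1]) = 0"
        using v(1) less.prems(1) by (intro less.hyps[of _ v z]) (auto simp: c)
      then show ?thesis by (simp add: split)
    next
      assume "v \<in> set ?c2"
      then have "walk_weight A (?c2 @ [hd ?c2]) = 0"
        using v(1) less.prems(1) by (intro less.hyps[of _ v z]) (auto simp: c)
      then show ?thesis by (simp add: split)
    qed
  qed
qed

lemma mat_power_carrier:
  "A \<in> carrier_mat n n \<Longrightarrow> mat_power A m \<in> carrier_mat n n"
  by (induction m) auto

text \<open>
  Induction on \<open>m\<close>: in each summand of an entry of \<open>A\<^sup>m * A\<close>, the last step of the walk, from
  some \<open>w\<close> to \<open>v\<close>, is moved into the factor \<open>r\<close>, which is why \<open>r\<close> has to be arbitrary.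
\<close>
lemma mult_mat_power_entry_eq_0:
  fixes A :: "'a :: {comm_ring, comm_monoid_mult} mat"
  assumes A: "A \<in> carrier_mat n n" and "u < n" "v < n"
    and "\<And>p. \<lbrakk>p \<noteq> []; hd p = u; last p = v; set p \<subseteq> {0..<n}\<rbrakk> \<Longrightarrow> r * walk_weight A p = 0"
  shows "r * mat_power A m $$ (u, v) = 0"
  using assms(3,4)
proof (induction m arbitrary: r v)
  case 0
  show ?case
    using 0(1) 0(2)[of "[u]"] A \<open>u < n\<close> by (cases "u = v") auto
next
  case (Suc m)
  have "r * (mat_power A m $$ (u, w) * A $$ (w, v)) = 0" if "w < n" for w
  proof -
    have "(r * A $$ (w, v)) * mat_power A m $$ (u, w) = 0"
    proof (rule Suc.IH[OF that])
      fix p assume p: "p \<noteq> []" "hd p = u" "last p = w" "set p \<subseteq> {0..<n}"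
      then have "r * walk_weight A (p @ [v]) = 0"
        using Suc.prems(1) by (intro Suc.prems(2)) auto
      with p show "r * A $$ (w, v) * walk_weight A p = 0"
        by (simp add: walk_weight_snoc mult_ac)
    qed
    then show ?thesis by (simp add: mult_ac)
  qed
  moreover have "mat_power A (Suc m) $$ (u, v) = (\<Sum>w = 0..<n. mat_power A m $$ (u, w) * A $$ (w, v))"
    using A mat_power_carrier[OF A, of m] \<open>u < n\<close> Suc.prems(1) by (simp add: scalar_prod_def)
  ultimately show ?case by (simp add: sum_distrib_left)
qed

text \<open>
  Multiplying out the product of entries of \<open>A\<^sup>m\<close> along \<open>c\<close> replaces each step of \<open>c\<close> by a walk
  with the same ends, so that it yields weights of walks through all vertices of \<open>c\<close>.
\<close>
lemma mult_walk_weight_mat_power_eq_0: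
  fixes A :: "'a :: {comm_ring, comm_monoid_mult} mat"
  assumes A: "A \<in> carrier_mat n n" and "c \<noteq> []" "set c \<subseteq> {0..<n}"
    and "\<And>p. \<lbrakk>p \<noteq> []; hd p = hd c; last p = last c; set c \<subseteq> set p; set p \<subseteq> {0..<n}\<rbrakk>
      \<Longrightarrow> r * walk_weight A p = 0"
  shows "r * walk_weight (mat_power A m) c = 0"
  using assms(2-)
proof (induction c arbitrary: r)
  case (Cons x c)
  show ?case
  proof (cases c)
    case Nil
    then show ?thesis using Cons.prems(2) Cons.prems(3)[of "[x]"] by simp
  next
    case c: (Cons y c')
    let ?B = "mat_power A m"
    have "(r * walk_weight ?B c) * ?B $$ (x, y) = 0"
    proof (rule mult_mat_power_entry_eq_0[OF A])
      fix p assume p: "p \<noteq> []" "hd p = x" "last p = y" "set p \<subseteq> {0..<n}"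
      have "(r * walk_weight A p) * walk_weight ?B c = 0"
      proof (rule Cons.IH)
        fix q assume q: "q \<noteq> []" "hd q = hd c" "last q = last c" "set c \<subseteq> set q" "set q \<subseteq> {0..<n}"
        \<comment> \<open>\<open>p\<close> ends at the vertex \<open>y\<close> where \<open>q\<close> starts, so concatenation must not repeat it.\<close>
        obtain p' where p_eq: "p = p' @ [y]" using p(1,3) by (cases p rule: rev_cases) auto
        obtain q' where q_eq: "q = y # q'" using q(1,2) c by (cases q) auto
        have x: "x \<in> set p" using p(1,2) by auto
        have "r * walk_weight A (p @ q') = 0"
        proof (rule Cons.prems(3))
          show "hd (p @ q') = hd (x # c)" using p(1,2) by simp
          show "last (p @ q') = last (x # c)" using q(3) c by (simp add: p_eq q_eq split: if_splits)
          show "set (x # c) \<subseteq> set (p @ q')" using x q(4) by (auto simp: p_eq q_eq)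
          show "set (p @ q') \<subseteq> {0..<n}" using p(4) q(5) by (auto simp: q_eq)
        qed (use p(1) in simp)
        moreover have "walk_weight A (p @ q') = walk_weight A p * walk_weight A q"
          using walk_weight_append[of A p' y q'] by (simp add: p_eq q_eq)
        ultimately show "r * walk_weight A p * walk_weight A q = 0" by (simp add: mult_ac)
      qed (use c Cons.prems in auto)
      then show "r * walk_weight ?B c * walk_weight A p = 0" by (simp add: mult_ac)
    qed (use c Cons.prems in auto)
    then show ?thesis by (simp add: c mult_ac)
  qed
qed simp

theorem proposition2p3:
  fixes A :: "'a :: {comm_ring, comm_monoid_mult} mat" and n m :: nat
  assumes "A \<in> carrier_mat n n"
    and "nullcyclic n A"
  shows "nullcyclic n (mat_power A m)"
  unfolding nullcyclic_def
proof (intro allI impI)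
  fix c assume "nontrivial_cycle n c"
  then have c: "distinct c" "set c \<subseteq> {0..<n}" "length c > 1"
    by (auto simp: nontrivial_cycle_def is_cycle_def)
  then have "c \<noteq> []" by auto
  have xy: "c ! 0 \<in> set c" "c ! 1 \<in> set c" "c ! 0 \<noteq> c ! 1"
    using c \<open>c \<noteq> []\<close> by (simp_all add: nth_eq_iff_index_eq)
  \<comment> \<open>The factor \<open>1\<close> plays the role of \<open>r\<close>: nothing is left aside at the start.\<close>
  have "1 * walk_weight (mat_power A m) (c @ [hd c]) = 0"
  proof (rule mult_walk_weight_mat_power_eq_0[OF assms(1)])
    fix p assume p: "p \<noteq> []" "hd p = hd (c @ [hd c])" "last p = last (c @ [hd c])"
      "set (c @ [hd c]) \<subseteq> set p" "set p \<subseteq> {0..<n}"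
    have "length p \<noteq> 1"
    proof
      assume "length p = 1"
      then obtain a where "set p = {a}" by (auto simp: length_Suc_conv)
      with p(4) have "set c \<subseteq> {a}" by simp
      with xy show False by blast
    qed
    with p(1) have "butlast p \<noteq> []" by (cases p rule: rev_cases) auto
    then have p_eq: "p = butlast p @ [hd (butlast p)]"
      using p(1-3) \<open>c \<noteq> []\<close> by (cases p rule: rev_cases) auto
    have "set p = set (butlast p)"
      using \<open>butlast p \<noteq> []\<close> by (subst p_eq) auto
    then have "walk_weight A (butlast p @ [hd (butlast p)]) = 0"
      using p(4,5) xy by (intro closed_walk_weight_eq_0[OF assms(2), of _ "c ! 0" "c ! 1"]) auto
    then show "1 * walk_weight A p = 0" using p_eq by simp
  qed (use c(2) hd_in_set[OF \<open>c \<noteq> []\<close>] in auto)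
  then show "cycle_weight (mat_power A m) c = 0"
    using cycle_weight_eq_walk_weight[OF \<open>c \<noteq> []\<close>, of "mat_power A m"] by simp
qed

end
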